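(* There exists a linear expanding map $f$ of the torus $\mathbb{T}^2$ such that for Lebesgue-almost all $x\in\mathbb{T}^2$ the limit below exists and $$\frac{1}{\Lambda^u}<\lim_{r\to0}\frac{\tau(B(x,r))}{-\log r}=\frac{2}{\Lambda^u+\lambda^u}<\frac{1}{\lambda^u}.$$
   Context: A linear expanding map of $\mathbb{T}^2=\mathbb{R}^2/\mathbb{Z}^2$ is a map $f(x)=Ax$ induced by an integer matrix $A$ all of whose eigenvalues have modulus larger than $1$ (a noninvertible endomorphism). $\lambda^u$ and $\Lambda^u$ denote respectively the smallest and the largest (positive) Lyapunov exponents of $f$, i.e. the logarithms of the smallest and largest moduli of the eigenvalues of $A$. $B(x,r)$ is the ball of radius $r$ around $x$ for the usual flat metric, and $\tau(E):=\min\{k>0: f^k(E)\cap E\neq\emptyset\}$ for $E\subset\mathbb{T}^2$. *)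

theory Defs
  imports "HOL-Analysis.Analysis"
begin

definition lattice_rel :: "real^2 \<Rightarrow> real^2 \<Rightarrow> bool" where
  "lattice_rel x y \<longleftrightarrow> (\<forall>i. x $ i - y $ i \<in> \<int>)"

lemma equivp_lattice_rel: "equivp lattice_rel"
proof (rule equivpI)
  show "reflp lattice_rel" by (auto simp: reflp_def lattice_rel_def)
  show "symp lattice_rel"
    unfolding symp_def lattice_rel_def by (metis Ints_minus minus_diff_eq)
  show "transp lattice_rel"
    unfolding transp_def lattice_rel_def
  proof (intro allI impI)
    fix x y z :: "real^2" and i
    assume "\<forall>i. x $ i - y $ i \<in> \<int>" "\<forall>i. y $ i - z $ i \<in> \<int>"
    then have "(x $ i - y $ i) + (y $ i - z $ i) \<in> \<int>" by (blast intro: Ints_add)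
    then show "x $ i - z $ i \<in> \<int>" by simp
  qed
qed

quotient_type torus2 = "real^2" / lattice_rel
  morphisms rep_torus2 torus_proj
  by (rule equivp_lattice_rel)

lemma torus_proj_eq_iff: "torus_proj x = torus_proj y \<longleftrightarrow> lattice_rel x y"
  by (rule torus2.abs_eq_iff)

lemma torus_proj_surj: "\<exists>x. torus_proj x = p"
  by (metis Quotient_abs_rep Quotient_torus2)

text \<open>The flat metric: the distance between two points is the least Euclidean distance
  between representatives.\<close>

instantiation torus2 :: metric_space
begin

definition dist_torus2 :: "torus2 \<Rightarrow> torus2 \<Rightarrow> real" where
  "dist_torus2 p q = Inf {dist x y | x y. torus_proj x = p \<and> torus_proj y = q}"

definition uniformity_torus2 :: "(torus2 \<times> torus2) filter" where
  "uniformity_torus2 = (INF e\<in>{0<..}. principal {(p, q). dist p q < e})"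

definition open_torus2 :: "torus2 set \<Rightarrow> bool" where
  "open_torus2 U \<longleftrightarrow> (\<forall>p\<in>U. eventually (\<lambda>(p', q). p' = p \<longrightarrow> q \<in> U) uniformity)"

lemma dist_torus2_less_iff:
  fixes p q :: torus2
  shows "dist p q < e \<longleftrightarrow> (\<exists>x y. torus_proj x = p \<and> torus_proj y = q \<and> dist x y < e)"
proof -
  let ?S = "{dist x y | x y. torus_proj x = p \<and> torus_proj y = q}"
  obtain x0 y0 where "torus_proj x0 = p" "torus_proj y0 = q"
    using torus_proj_surj by metis
  then have "dist x0 y0 \<in> ?S" by auto
  then have "?S \<noteq> {}" by auto
  moreover have "bdd_below ?S" by (rule bdd_belowI[of _ 0]) auto
  ultimately show ?thesis
    unfolding dist_torus2_def by (subst cInf_less_iff) auto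
qed

instance
proof
  show "uniformity = (INF e\<in>{0<..}. principal {(p::torus2, q). dist p q < e})"
    by (rule uniformity_torus2_def)
  show "open U \<longleftrightarrow> (\<forall>p\<in>U. eventually (\<lambda>(p', q). p' = p \<longrightarrow> q \<in> U) uniformity)"
    for U :: "torus2 set" by (rule open_torus2_def)
  show "dist p q = 0 \<longleftrightarrow> p = q" for p q :: torus2
  proof
    assume *: "dist p q = 0"
    obtain x0 y0 where p: "torus_proj x0 = p" and q: "torus_proj y0 = q"
      using torus_proj_surj by metis
    have "x0 $ i - y0 $ i \<in> closure \<int>" for i
    proof (subst closure_approachable, intro allI impI)
      fix e :: real assume "e > 0"
      then obtain x y where xy: "torus_proj x = p" "torus_proj y = q" "dist x y < e"
        using * dist_torus2_less_iff[of p q e] by auto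
      have 1: "x0 $ i - x $ i \<in> \<int>" "y0 $ i - y $ i \<in> \<int>"
        using xy p q torus_proj_eq_iff unfolding lattice_rel_def by blast+
      have "dist (x $ i) (y $ i) < e"
        using xy(3) dist_vec_nth_le[of x i y] by simp
      then have "dist ((x0 $ i - x $ i) - (y0 $ i - y $ i)) (x0 $ i - y0 $ i) < e"
        by (simp add: dist_real_def)
      with 1 show "\<exists>m\<in>\<int>. dist m (x0 $ i - y0 $ i) < e"
        by (blast intro: Ints_diff)
    qed
    then have "lattice_rel x0 y0" by (simp add: lattice_rel_def)
    then show "p = q" using p q torus_proj_eq_iff by blast
  next
    assume "p = q"
    obtain x where "torus_proj x = p" using torus_proj_surj by blast
    then have "dist p q < e" if "e > 0" for e
      using that \<open>p = q\<close> dist_torus2_less_iff[of p q e] by (metis dist_self)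
    moreover have "\<not> dist p q < 0"
      using dist_torus2_less_iff[of p q 0] by simp
    ultimately show "dist p q = 0" by (metis linorder_neqE_linordered_idom order_less_irrefl)
  qed
  show "dist p q \<le> dist p s + dist q s" for p q s :: torus2
  proof (rule field_le_epsilon)
    fix e :: real assume e: "e > 0"
    obtain x z where xz: "torus_proj x = p" "torus_proj z = s" "dist x z < dist p s + e/2"
      using e dist_torus2_less_iff[of p s "dist p s + e/2"] by auto
    obtain y z' where yz: "torus_proj y = q" "torus_proj z' = s" "dist y z' < dist q s + e/2"
      using e dist_torus2_less_iff[of q s "dist q s + e/2"] by auto
    have "lattice_rel z z'" using xz(2) yz(2) torus_proj_eq_iff[of z z'] by simp
    then have "lattice_rel (y + (z - z')) y" by (simp add: lattice_rel_def)
    then have w: "torus_proj (y + (z - z')) = q"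
      using yz(1) torus_proj_eq_iff[of "y + (z - z')" y] by simp
    have "z - (y + (z - z')) = z' - y" by simp
    then have "dist z (y + (z - z')) = dist y z'"
      by (metis dist_norm dist_commute)
    then have "dist x (y + (z - z')) \<le> dist x z + dist y z'"
      using dist_triangle[of x "y + (z - z')" z] by simp
    also have "\<dots> < dist p s + dist q s + e"
      using xz(3) yz(3) by linarith
    finally have "dist x (y + (z - z')) < dist p s + dist q s + e" .
    with xz(1) w have "dist p q < dist p s + dist q s + e"
      by (intro iffD2[OF dist_torus2_less_iff] exI conjI)
    then show "dist p q \<le> dist p s + dist q s + e" by (rule order_less_imp_le)
  qed
qed

end

lemma dist_torus_proj_le: "dist (torus_proj x) (torus_proj y) \<le> dist x y"
proof (rule dense_ge)
  fix e assume "dist x y < e"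
  then have "\<exists>x' y'. torus_proj x' = torus_proj x \<and> torus_proj y' = torus_proj y \<and> dist x' y' < e"
    by (intro exI[of _ x] exI[of _ y] conjI refl)
  then have "dist (torus_proj x) (torus_proj y) < e"
    by (rule iffD2[OF dist_torus2_less_iff])
  then show "dist (torus_proj x) (torus_proj y) \<le> e"
    by (rule order_less_imp_le)
qed

lemma borel_measurable_torus_proj: "torus_proj \<in> borel_measurable borel"
proof (rule borel_measurable_continuous_onI)
  show "continuous_on UNIV torus_proj"
    unfolding continuous_on_iff
  proof (intro ballI allI impI)
    fix x :: "real^2" and e :: real assume "e > 0"
    moreover have "dist (torus_proj y) (torus_proj x) < e" if "dist y x < e" for y
      using dist_torus_proj_le that by (rule le_less_trans)
    ultimately show "\<exists>d>0. \<forall>y\<in>UNIV. dist y x < d \<longrightarrow> dist (torus_proj y) (torus_proj x) < e"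
      by (intro exI[of _ e]) simp
  qed
qed

definition unit_square :: "(real^2) set" where
  "unit_square = {x. \<forall>i. 0 \<le> x $ i \<and> x $ i < 1}"

text \<open>Lebesgue (Haar) measure on the torus: the image of planar Lebesgue measure
  on the fundamental domain.\<close>

definition torus_lebesgue :: "torus2 measure" where
  "torus_lebesgue = distr (restrict_space lborel unit_square) borel torus_proj"

lemma unit_square_borel: "unit_square \<in> sets borel"
proof -
  have "unit_square = (\<Inter>i. {x. 0 \<le> x $ i} \<inter> {x. x $ i < 1})"
    by (auto simp: unit_square_def)
  also have "\<dots> \<in> sets borel" by measurable
  finally show ?thesis .
qed

text \<open>\<^const>\<open>distr\<close> is a genuine image measure because the projection is measurable.\<close>

lemma emeasure_torus_lebesgue:
  assumes "E \<in> sets borel"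
  shows "emeasure torus_lebesgue E = emeasure lborel (torus_proj -` E \<inter> unit_square)"
proof -
  have m: "torus_proj \<in> restrict_space lborel unit_square \<rightarrow>\<^sub>M borel"
    by (rule measurable_restrict_space1) (simp add: borel_measurable_torus_proj)
  show ?thesis
    unfolding torus_lebesgue_def
    by (subst emeasure_distr[OF m assms], subst emeasure_restrict_space)
       (auto simp: space_restrict_space unit_square_borel)
qed

definition of_int_matrix :: "int^'n^'m \<Rightarrow> 'a::ring_1^'n^'m" where
  "of_int_matrix A = (\<chi> i j. of_int (A $ i $ j))"

lift_definition torus_map :: "int^2^2 \<Rightarrow> torus2 \<Rightarrow> torus2" is
  "\<lambda>A x. of_int_matrix A *v x"
proof -
  fix A :: "int^2^2" and x y :: "real^2"
  assume "lattice_rel x y"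
  then have "(\<Sum>j\<in>UNIV. of_int (A $ i $ j) * (x $ j - y $ j)) \<in> \<int>" for i
    unfolding lattice_rel_def by (intro Ints_sum Ints_mult) auto
  then show "lattice_rel (of_int_matrix A *v x) (of_int_matrix A *v y)"
    by (simp add: lattice_rel_def of_int_matrix_def matrix_vector_mult_def
        right_diff_distrib sum_subtractf)
qed

definition eigenvalues :: "int^'n^'n \<Rightarrow> complex set" where
  "eigenvalues A = {\<mu>. \<exists>v. v \<noteq> 0 \<and> of_int_matrix A *v v = \<mu> *s v}"

definition expanding_matrix :: "int^2^2 \<Rightarrow> bool" where
  "expanding_matrix A \<longleftrightarrow> (\<forall>\<mu>\<in>eigenvalues A. cmod \<mu> > 1)"

definition min_lyapunov :: "int^2^2 \<Rightarrow> real" where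
  "min_lyapunov A = ln (Min (cmod ` eigenvalues A))"

definition max_lyapunov :: "int^2^2 \<Rightarrow> real" where
  "max_lyapunov A = ln (Max (cmod ` eigenvalues A))"

text \<open>The value is \<open>\<infinity>\<close> if \<open>E\<close> never returns to itself.\<close>

definition return_time :: "('a \<Rightarrow> 'a) \<Rightarrow> 'a set \<Rightarrow> enat" where
  "return_time f E = Inf {enat k | k. k > 0 \<and> (f ^^ k) ` E \<inter> E \<noteq> {}}"

end

theory Submission
  imports Defs "HOL-Real_Asymp.Real_Asymp"
begin

text \<open>
  The example is multiplication by \<open>(5 + sqrt 5) / 2\<close> on the ring of integers of \<open>\<rat>(sqrt 5)\<close>, that
  is, the matrix \<open>A\<close> with rows \<open>(3, 1)\<close> and \<open>(1, 2)\<close>. Its eigenvalues \<open>(5 \<plusminus> sqrt 5) / 2\<close> are distinct,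
  larger than \<open>1\<close>, and have product \<open>5\<close>; so the exponents are distinct and positive with sum \<open>ln 5\<close>,
  and the two strict inequalities are immediate. It remains to show that the limit is \<open>2 / ln 5\<close>
  almost everywhere.

  Upper bound, at every point: \<open>A\<^sup>2 = 5 F\<close> with \<open>F\<close> unimodular, so \<open>A\<^sup>-\<^sup>2\<^sup>j \<int>\<^sup>2 = 5\<^sup>-\<^sup>j \<int>\<^sup>2\<close>. This square
  lattice meets every disc of radius \<open>5\<^sup>-\<^sup>j\<close>, hence \<open>f\<^sup>2\<^sup>j\<close> maps each ball of radius \<open>r > 5\<^sup>-\<^sup>j\<close> onto the
  torus, and the return time is at most \<open>2j\<close> (\<open>return_time_le\<close>).

  Lower bound, almost everywhere: since \<open>|Av| \<ge> 5/4 |v|\<close>, the map \<open>A\<^sup>k - I\<close> contracts lengths at most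
  by the factor \<open>4\<close>, so a return of \<open>B(x, r)\<close> at time \<open>k\<close> forces \<open>x\<close> to lie within \<open>9r\<close> of a fixed
  point of \<open>f\<^sup>k\<close> (\<open>return_imp_near_fixed_lift\<close>). A volume count gives at most a constant times \<open>5\<^sup>k\<close> such
  fixed points (\<open>card_fixed_lifts_le\<close>), so the points whose ball of radius \<open>r\<close> returns by time \<open>N\<close> form
  a set of measure \<open>O(5\<^sup>N r\<^sup>2)\<close>. With \<open>r = 5\<^sup>-\<^sup>m\<close> and \<open>N = 2m - O(ln m)\<close> these measures are summable, and
  the Borel-Cantelli lemma applies (\<open>AE_eventually_not_early_returns\<close>). Monotonicity in \<open>r\<close> extends
  the bound from the radii \<open>5\<^sup>-\<^sup>m\<close> to all small radii.
\<close>

section \<open>The matrix and its exponents\<close>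

text \<open>The square of this matrix is five times the square of the Fibonacci matrix with rows
  \<open>(1, 1)\<close> and \<open>(1, 0)\<close>.\<close>

definition fib_matrix :: "int^2^2" where
  "fib_matrix = vector [vector [3, 1], vector [1, 2]]"

text \<open>The linear map of the plane with this matrix, a lift of the torus map.\<close>

definition fib_map :: "real^2 \<Rightarrow> real^2" where
  "fib_map v = vector [3 * v $ 1 + v $ 2, v $ 1 + 2 * v $ 2]"

lemma of_int_fib_matrix_mult: "of_int_matrix fib_matrix *v v = fib_map v"
  by (simp add: vec_eq_iff forall_2 fib_map_def fib_matrix_def of_int_matrix_def
      matrix_vector_mult_def sum_2)

lemma eigenvalues_fib_matrix:
  "eigenvalues fib_matrix = {of_real ((5 + sqrt 5) / 2), of_real ((5 - sqrt 5) / 2)}"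
proof -
  have mv: "of_int_matrix fib_matrix *v v = \<mu> *s v \<longleftrightarrow>
      3 * v $ 1 + v $ 2 = \<mu> * v $ 1 \<and> v $ 1 + 2 * v $ 2 = \<mu> * v $ 2" for v :: "complex^2" and \<mu>
    by (simp add: vec_eq_iff forall_2 fib_matrix_def of_int_matrix_def
        matrix_vector_mult_def sum_2)
  have s: "complex_of_real (sqrt 5) * complex_of_real (sqrt 5) = 5"
    by (simp flip: of_real_mult)
  have char_poly: "\<mu> * \<mu> - 5 * \<mu> + 5 =
      (\<mu> - of_real ((5 + sqrt 5) / 2)) * (\<mu> - of_real ((5 - sqrt 5) / 2))" for \<mu> :: complex
    using s by (simp add: field_simps)
  have "\<mu> \<in> eigenvalues fib_matrix \<longleftrightarrow> \<mu> * \<mu> - 5 * \<mu> + 5 = 0" for \<mu> :: complex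
  proof
    assume "\<mu> \<in> eigenvalues fib_matrix"
    then obtain v :: "complex^2" where v: "v \<noteq> 0"
      and e: "3 * v $ 1 + v $ 2 = \<mu> * v $ 1" "v $ 1 + 2 * v $ 2 = \<mu> * v $ 2"
      unfolding eigenvalues_def mv by auto
    have "(\<mu> * \<mu> - 5 * \<mu> + 5) * v $ 1 = 0" "(\<mu> * \<mu> - 5 * \<mu> + 5) * v $ 2 = 0"
      using e by algebra+
    moreover have "v $ 1 \<noteq> 0 \<or> v $ 2 \<noteq> 0" using v by (auto simp: vec_eq_iff forall_2)
    ultimately show "\<mu> * \<mu> - 5 * \<mu> + 5 = 0" by auto
  next
    assume 0: "\<mu> * \<mu> - 5 * \<mu> + 5 = 0"
    let ?v = "vector [1, \<mu> - 3] :: complex^2"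
    have "?v \<noteq> 0" by (auto simp: vec_eq_iff forall_2)
    moreover have "of_int_matrix fib_matrix *v ?v = \<mu> *s ?v"
      unfolding mv using 0 by (simp add: algebra_simps)
    ultimately show "\<mu> \<in> eigenvalues fib_matrix" unfolding eigenvalues_def by blast
  qed
  then show ?thesis
    unfolding char_poly mult_eq_0_iff right_minus_eq set_eq_iff
    by (simp only: insert_iff empty_iff simp_thms)
qed

lemma sqrt_5_bounds: "2 < sqrt 5" "sqrt 5 < 3"
  by (simp_all add: real_less_rsqrt real_less_lsqrt)

lemma cmod_eigenvalues_fib_matrix:
  "cmod ` eigenvalues fib_matrix = {(5 + sqrt 5) / 2, (5 - sqrt 5) / 2}"
proof -
  have "cmod (of_real ((5 + sqrt 5) / 2)) = (5 + sqrt 5) / 2"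
    "cmod (of_real ((5 - sqrt 5) / 2)) = (5 - sqrt 5) / 2"
    unfolding norm_of_real using sqrt_5_bounds by auto
  then show ?thesis unfolding eigenvalues_fib_matrix image_insert image_empty by (simp only:)
qed

lemma expanding_fib_matrix: "expanding_matrix fib_matrix"
proof -
  have "\<forall>t\<in>cmod ` eigenvalues fib_matrix. t > 1"
    unfolding cmod_eigenvalues_fib_matrix using sqrt_5_bounds by auto
  then show ?thesis by (simp add: expanding_matrix_def)
qed

lemma lyapunov_fib_matrix:
  "max_lyapunov fib_matrix = ln ((5 + sqrt 5) / 2)"
  "min_lyapunov fib_matrix = ln ((5 - sqrt 5) / 2)"
  using sqrt_5_bounds
  unfolding max_lyapunov_def min_lyapunov_def cmod_eigenvalues_fib_matrix by simp_all

lemma min_lyapunov_fib_matrix_pos: "0 < min_lyapunov fib_matrix"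
  unfolding lyapunov_fib_matrix using sqrt_5_bounds by simp

lemma min_less_max_lyapunov_fib_matrix: "min_lyapunov fib_matrix < max_lyapunov fib_matrix"
  unfolding lyapunov_fib_matrix using sqrt_5_bounds by simp

lemma sum_lyapunov_fib_matrix: "max_lyapunov fib_matrix + min_lyapunov fib_matrix = ln 5"
proof -
  have "(5 + sqrt 5) / 2 * ((5 - sqrt 5) / 2) = 5" by (simp add: field_simps)
  then show ?thesis
    unfolding lyapunov_fib_matrix using sqrt_5_bounds by (subst ln_mult_pos[symmetric]) auto
qed

section \<open>The lifted dynamics\<close>

lemma linear_fib_map: "linear fib_map"
  by (rule linearI)
     (auto simp: fib_map_def vec_eq_iff forall_2 algebra_simps)

lemma linear_fib_map_funpow: "linear (fib_map ^^ k)"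
proof (induction k)
  case (Suc k)
  then show ?case using linear_compose[OF _ linear_fib_map, of "fib_map ^^ k"] by (simp add: o_def)
qed (simp add: linear_iff)

lemma inj_fib_map: "inj fib_map"
  by (rule injI) (auto simp: fib_map_def vec_eq_iff forall_2)

lemma surj_fib_map_funpow: "surj (fib_map ^^ k)"
  using linear_inj_imp_surj[OF linear_fib_map inj_fib_map] by (rule surj_fn)

lemma torus_map_funpow_proj:
  "(torus_map fib_matrix ^^ k) (torus_proj x) = torus_proj ((fib_map ^^ k) x)"
  by (induction k) (simp_all add: torus_map.abs_eq of_int_fib_matrix_mult)

text \<open>The constant only has to be larger than \<open>1\<close> and below the smaller eigenvalue, which is the
  least expansion factor because the matrix is symmetric; \<open>5/4\<close> is a convenient such value.\<close>

lemma norm_fib_map_ge: "5 / 4 * norm v \<le> norm (fib_map v)"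
proof -
  have "(5 / 4 * norm v)\<^sup>2 \<le> (norm (fib_map v))\<^sup>2"
  proof -
    let ?a = "v $ 1" and ?b = "v $ 2"
    have sq: "(norm w)\<^sup>2 = (w $ 1)\<^sup>2 + (w $ 2)\<^sup>2" for w :: "real^2"
      unfolding power2_norm_eq_inner by (simp add: inner_vec_def sum_2 power2_eq_square)
    have "(norm (fib_map v))\<^sup>2 - (5 / 4 * norm v)\<^sup>2
        = 10 * ?a\<^sup>2 + 10 * ?a * ?b + 5 * ?b\<^sup>2 - 25 / 16 * (?a\<^sup>2 + ?b\<^sup>2)"
      unfolding power_mult_distrib sq by (simp add: fib_map_def power2_eq_square algebra_simps)
    also have "\<dots> = 8 * (?a + 5 / 8 * ?b)\<^sup>2 + 7 / 16 * ?a\<^sup>2 + 5 / 16 * ?b\<^sup>2"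
      by (simp add: power2_eq_square algebra_simps)
    finally show ?thesis
      using zero_le_power2[of "?a + 5 / 8 * ?b"] zero_le_power2[of ?a] zero_le_power2[of ?b]
      by linarith
  qed
  then show ?thesis by (rule power2_le_imp_le) simp
qed

lemma norm_fib_map_funpow_ge: "(5 / 4) ^ k * norm v \<le> norm ((fib_map ^^ k) v)"
proof (induction k)
  case (Suc k)
  have "(5 / 4) ^ Suc k * norm v = 5 / 4 * ((5 / 4) ^ k * norm v)" by simp
  also have "\<dots> \<le> 5 / 4 * norm ((fib_map ^^ k) v)" using Suc by (intro mult_left_mono) auto
  also have "\<dots> \<le> norm ((fib_map ^^ Suc k) v)" using norm_fib_map_ge by simp
  finally show ?case .
qed simp

lemma norm_fib_map_funpow_minus_ge:
  assumes "k > 0"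
  shows "norm v / 4 \<le> norm ((fib_map ^^ k) v - v)"
proof -
  have "5 / 4 \<le> (5 / 4 :: real) ^ k" using power_increasing[of 1 k "5 / 4 :: real"] assms by simp
  then have "5 / 4 * norm v \<le> (5 / 4) ^ k * norm v" by (rule mult_right_mono) simp
  also have "\<dots> \<le> norm ((fib_map ^^ k) v)" by (rule norm_fib_map_funpow_ge)
  finally show ?thesis using norm_triangle_ineq2[of "(fib_map ^^ k) v" v] by simp
qed

lemma linear_fib_map_funpow_minus: "linear (\<lambda>v. (fib_map ^^ k) v - v)"
  by (rule linear_compose_sub[OF linear_fib_map_funpow linear_ident])

lemma inj_fib_map_funpow_minus:
  assumes "k > 0"
  shows "inj (\<lambda>v. (fib_map ^^ k) v - v)"
  unfolding linear_injective_0[OF linear_fib_map_funpow_minus]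
proof (intro allI impI)
  fix v assume "(fib_map ^^ k) v - v = 0"
  then show "v = 0" using norm_fib_map_funpow_minus_ge[OF assms, of v] by simp
qed

lemma surj_fib_map_funpow_minus:
  assumes "k > 0"
  shows "surj (\<lambda>v. (fib_map ^^ k) v - v)"
  using linear_inj_imp_surj[OF linear_fib_map_funpow_minus inj_fib_map_funpow_minus[OF assms]] .

lemma lattice_rel_refl [simp]: "lattice_rel x x"
  by (simp add: lattice_rel_def)

lemma lattice_rel_sym: "lattice_rel x y \<Longrightarrow> lattice_rel y x"
  using equivp_symp[OF equivp_lattice_rel] .

lemma lattice_rel_trans: "lattice_rel x y \<Longrightarrow> lattice_rel y z \<Longrightarrow> lattice_rel x z"
  using equivp_transp[OF equivp_lattice_rel] .

lemma lattice_rel_fib_map_funpow: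
  "lattice_rel x y \<Longrightarrow> lattice_rel ((fib_map ^^ k) x) ((fib_map ^^ k) y)"
  unfolding torus_proj_eq_iff[symmetric] torus_map_funpow_proj[symmetric] by (rule arg_cong)

lemma lattice_rel_add: "lattice_rel x y \<Longrightarrow> lattice_rel x' y' \<Longrightarrow> lattice_rel (x + x') (y + y')"
  unfolding lattice_rel_def by (simp add: add_diff_add)

text \<open>In the definition of the flat metric the representative of one of the points can be
  prescribed.\<close>

lemma dist_torus_proj_less_iff:
  "dist (torus_proj x) q < r \<longleftrightarrow> (\<exists>y. torus_proj y = q \<and> dist x y < r)"
proof
  assume "dist (torus_proj x) q < r"
  then obtain x' y' where *: "torus_proj x' = torus_proj x" "torus_proj y' = q" "dist x' y' < r"
    by (auto simp: dist_torus2_less_iff)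
  have "lattice_rel (y' + (x - x')) y'"
    using *(1) lattice_rel_sym[of x' x] by (simp add: torus_proj_eq_iff lattice_rel_def)
  moreover have "dist x (y' + (x - x')) < r" using *(3) by (simp add: dist_norm)
  ultimately show "\<exists>y. torus_proj y = q \<and> dist x y < r"
    using *(2) by (intro exI[of _ "y' + (x - x')"]) (auto simp: torus_proj_eq_iff)
next
  assume "\<exists>y. torus_proj y = q \<and> dist x y < r"
  then show "dist (torus_proj x) q < r" by (auto simp: dist_torus2_less_iff)
qed

section \<open>Return times from above\<close>

lemma fib_map_twice:
  "fib_map (fib_map v) = 5 *\<^sub>R vector [2 * v $ 1 + v $ 2, v $ 1 + v $ 2]"
  by (simp add: fib_map_def vec_eq_iff forall_2)

text \<open>Every point of the torus has a preimage under the \<open>2j\<close>-th iterate within \<open>5\<^sup>-\<^sup>j\<close> of the origin.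
  The induction step peels off one factor \<open>5F\<close>: a small preimage of \<open>F\<^sup>-\<^sup>1 w\<close> divided by \<open>5\<close> is a
  preimage of \<open>w\<close>, modulo the lattice, which \<open>F\<close> preserves.\<close>

lemma exists_small_preimage_mod_lattice:
  "\<exists>v. norm v \<le> (1 / 5) ^ j \<and> lattice_rel ((fib_map ^^ (2 * j)) v) w"
proof (induction j arbitrary: w)
  case 0
  define v :: "real^2" where "v = (\<chi> i. w $ i - of_int (round (w $ i)))"
  have half: "\<bar>v $ i\<bar> \<le> 1 / 2" for i
    using of_int_round_abs_le[of "w $ i"] by (simp add: v_def abs_minus_commute)
  have "norm v \<le> \<bar>v $ 1\<bar> + \<bar>v $ 2\<bar>"
    using norm_le_l1_cart[of v] by (simp add: sum_2)
  then have "norm v \<le> 1" using half[of 1] half[of 2] by simp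
  moreover have "lattice_rel v w" by (simp add: lattice_rel_def v_def)
  ultimately show ?case by auto
next
  case (Suc j)
  \<comment> \<open>\<open>?F\<close> is the unimodular factor \<open>F\<close>, and \<open>?G\<close> its inverse.\<close>
  let ?F = "\<lambda>v. vector [2 * v $ 1 + v $ 2, v $ 1 + v $ 2] :: real^2"
  let ?G = "\<lambda>v. vector [v $ 1 - v $ 2, 2 * v $ 2 - v $ 1] :: real^2"
  obtain v where v: "norm v \<le> (1 / 5) ^ j" "lattice_rel ((fib_map ^^ (2 * j)) v) (?G w)"
    using Suc.IH by blast
  have F: "lattice_rel (?F x) (?F y)" if "lattice_rel x y" for x y
  proof -
    have d: "x $ i - y $ i \<in> \<int>" for i using that by (simp add: lattice_rel_def)
    have "2 * (x $ 1 - y $ 1) + (x $ 2 - y $ 2) \<in> \<int>" "(x $ 1 - y $ 1) + (x $ 2 - y $ 2) \<in> \<int>"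
      by (intro Ints_add Ints_mult d; simp)+
    then show ?thesis by (simp add: lattice_rel_def forall_2 algebra_simps)
  qed
  have "(fib_map ^^ (2 * Suc j)) ((1 / 5) *\<^sub>R v)
      = fib_map (fib_map ((fib_map ^^ (2 * j)) ((1 / 5) *\<^sub>R v)))" by simp
  also have "\<dots> = (1 / 5) *\<^sub>R fib_map (fib_map ((fib_map ^^ (2 * j)) v))"
    by (simp add: linear_cmul[OF linear_fib_map] linear_cmul[OF linear_fib_map_funpow])
  also have "\<dots> = ?F ((fib_map ^^ (2 * j)) v)" by (simp add: fib_map_twice)
  finally have "lattice_rel ((fib_map ^^ (2 * Suc j)) ((1 / 5) *\<^sub>R v)) (?F (?G w))"
    using F[OF v(2)] by simp
  moreover have "?F (?G w) = w" by (simp add: vec_eq_iff forall_2)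
  moreover have "norm ((1 / 5) *\<^sub>R v) \<le> (1 / 5) ^ Suc j" using v(1) by simp
  ultimately show ?case by (intro exI[of _ "(1 / 5) *\<^sub>R v"] conjI) (simp_all only:)
qed

text \<open>The point of the ball that is found here returns exactly to the centre.\<close>

lemma return_time_le:
  assumes "j > 0" and "(1 / 5) ^ j < r"
  shows "return_time (torus_map fib_matrix) (ball p r) \<le> enat (2 * j)"
proof -
  obtain x where x: "torus_proj x = p" using torus_proj_surj by blast
  let ?T = "fib_map ^^ (2 * j)"
  obtain v where v: "norm v \<le> (1 / 5) ^ j" "lattice_rel (?T v) (x - ?T x)"
    using exists_small_preimage_mod_lattice by blast
  have r: "0 < r" using assms(2) by (rule le_less_trans[rotated]) simp
  have "lattice_rel (?T x + ?T v) (?T x + (x - ?T x))"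
    using v(2) by (intro lattice_rel_add) auto
  then have "torus_proj (?T (x + v)) = p"
    by (simp add: linear_add[OF linear_fib_map_funpow] x[symmetric] torus_proj_eq_iff)
  then have "(torus_map fib_matrix ^^ (2 * j)) (torus_proj (x + v)) = p"
    by (simp add: torus_map_funpow_proj)
  moreover have "torus_proj (x + v) \<in> ball p r"
    using v(1) assms(2) dist_torus_proj_le[of x "x + v"] by (simp add: x dist_norm)
  moreover have "p \<in> ball p r" using r by simp
  ultimately have "(torus_map fib_matrix ^^ (2 * j)) ` ball p r \<inter> ball p r \<noteq> {}" by blast
  then show ?thesis unfolding return_time_def using assms(1) by (intro Inf_lower) auto
qed

section \<open>Counting periodic points\<close>

text \<open>The points of the plane above the fixed points of the \<open>k\<close>-th iterate of the torus map.\<close>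

definition fixed_lifts :: "nat \<Rightarrow> (real^2) set" where
  "fixed_lifts k = {p. lattice_rel ((fib_map ^^ k) p) p}"

lemma return_imp_near_fixed_lift:
  assumes "k > 0"
    and "(torus_map fib_matrix ^^ k) ` ball (torus_proj x) r \<inter> ball (torus_proj x) r \<noteq> {}"
  shows "\<exists>p\<in>fixed_lifts k. dist x p < 9 * r"
proof -
  let ?T = "fib_map ^^ k"
  obtain q where q: "dist (torus_proj x) q < r"
      "dist (torus_proj x) ((torus_map fib_matrix ^^ k) q) < r"
    using assms(2) by auto
  obtain y where y: "torus_proj y = q" "dist x y < r"
    using q(1) dist_torus_proj_less_iff by blast
  obtain z where z: "torus_proj z = (torus_map fib_matrix ^^ k) q" "dist x z < r"
    using q(2) dist_torus_proj_less_iff by blast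
  have Tyz: "lattice_rel (?T y) z"
    unfolding torus_proj_eq_iff[symmetric] torus_map_funpow_proj[symmetric] y(1) z(1) ..
  \<comment> \<open>\<open>?T y - z\<close> is a lattice vector, so the solution \<open>p\<close> lies above a fixed point.\<close>
  obtain p where p: "?T p - p = ?T y - z"
    using surjD[OF surj_fib_map_funpow_minus[OF assms(1)], of "?T y - z"] by auto
  have "?T p $ i - p $ i \<in> \<int>" for i
  proof -
    have "?T p $ i - p $ i = ?T y $ i - z $ i" using arg_cong[OF p, of "\<lambda>v. v $ i"] by simp
    then show ?thesis using Tyz by (simp add: lattice_rel_def)
  qed
  then have "p \<in> fixed_lifts k" by (simp add: fixed_lifts_def lattice_rel_def)
  moreover have "dist x p < 9 * r"
  proof -
    have "?T (y - p) - (y - p) = (?T y - y) - (?T p - p)"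
      by (simp add: linear_diff[OF linear_fib_map_funpow])
    then have "?T (y - p) - (y - p) = z - y" using p by simp
    then have "norm (y - p) / 4 \<le> norm (z - y)"
      using norm_fib_map_funpow_minus_ge[OF assms(1), of "y - p"] by (simp only:)
    then have "dist y p \<le> 4 * dist z y" by (simp add: dist_norm)
    moreover have "dist z y \<le> dist x z + dist x y" by (metis dist_commute dist_triangle)
    moreover have "dist x p \<le> dist x y + dist y p" by (rule dist_triangle)
    ultimately show ?thesis using y(2) z(2) by linarith
  qed
  ultimately show ?thesis by blast
qed

lemma det_fib_map: "det (matrix fib_map) = 5"
  by (simp add: det_2 matrix_def fib_map_def axis_def)

lemma fib_map_funpow_image:
  assumes "S \<in> lmeasurable"
  shows "(fib_map ^^ k) ` S \<in> lmeasurable"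
    and "measure lebesgue ((fib_map ^^ k) ` S) = 5 ^ k * measure lebesgue S"
proof (induction k)
  case 0
  show "(fib_map ^^ 0) ` S \<in> lmeasurable"
    "measure lebesgue ((fib_map ^^ 0) ` S) = 5 ^ 0 * measure lebesgue S"
    using assms by auto
next
  case (Suc k)
  have image: "(fib_map ^^ Suc k) ` S = fib_map ` (fib_map ^^ k) ` S" by (simp add: image_comp)
  show "(fib_map ^^ Suc k) ` S \<in> lmeasurable"
    unfolding image by (rule measurable_linear_image[OF linear_fib_map Suc(1)])
  show "measure lebesgue ((fib_map ^^ Suc k) ` S) = 5 ^ Suc k * measure lebesgue S"
    unfolding image measure_linear_image[OF linear_fib_map Suc(1)] det_fib_map Suc(2) by simp
qed

lemma measure_lebesgue_disc:
  "0 \<le> r \<Longrightarrow> measure lebesgue (ball (c :: real^2) r) = pi * r\<^sup>2"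
  using content_ball[of r c] by (simp add: measure_completion unit_ball_vol_2)

text \<open>The map \<open>A\<^sup>k - I\<close> sends distinct points above fixed points to distinct lattice points, so the discs
  of radius \<open>1/2\<close> around the images are disjoint. If the points have norm at most \<open>12\<close>, these discs
  all lie in the image of a disc of radius \<open>25\<close> under \<open>A\<^sup>k\<close>, whose area is \<open>5\<^sup>k\<close> times that of the disc;
  the constant \<open>2500\<close> is the ratio of the areas of the two discs. The radius \<open>12\<close> is chosen to
  cover all points within distance \<open>9\<close> of the unit square.\<close>

lemma card_fixed_lifts_le:
  assumes "k > 0"
  shows "finite (fixed_lifts k \<inter> cball 0 12)" "card (fixed_lifts k \<inter> cball 0 12) \<le> 2500 * 5 ^ k"
proof -
  let ?T = "fib_map ^^ k"
  let ?M = "\<lambda>p. ?T p - p"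
  have "card G \<le> 2500 * 5 ^ k" if G: "G \<subseteq> fixed_lifts k \<inter> cball 0 12" "finite G" for G
  proof -
    have "disjnt (ball (?M p) (1 / 2)) (ball (?M q) (1 / 2))"
      if "p \<in> G" "q \<in> G" "p \<noteq> q" for p q
    proof -
      have "?M p \<noteq> ?M q"
        using that(3) inj_fib_map_funpow_minus[OF assms] by (auto dest: injD)
      then obtain i where i: "?M p $ i \<noteq> ?M q $ i" by (auto simp: vec_eq_iff)
      have "?M p $ i \<in> \<int>" "?M q $ i \<in> \<int>"
        using that(1,2) G(1) by (auto simp: fixed_lifts_def lattice_rel_def)
      then have "1 \<le> \<bar>?M p $ i - ?M q $ i\<bar>"
        using i by (intro Ints_nonzero_abs_ge1) auto
      also have "\<dots> \<le> dist (?M p) (?M q)"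
        using dist_vec_nth_le[of "?M p" i "?M q"] by (simp add: dist_real_def)
      finally show ?thesis unfolding disjnt_def by (intro disjoint_ballI) simp
    qed
    then have "measure lebesgue (\<Union>p\<in>G. ball (?M p) (1 / 2))
        = (\<Sum>p\<in>G. measure lebesgue (ball (?M p) (1 / 2)))"
      using G(2) by (intro measure_UNION') (auto simp: pairwise_def)
    also have "\<dots> = card G * (pi / 4)"
    proof -
      have "measure lebesgue (ball (c :: real^2) (1 / 2)) = pi / 4" for c
        by (subst measure_lebesgue_disc) (simp_all add: power2_eq_square)
      then show ?thesis by (simp only: sum_constant)
    qed
    finally have union: "measure lebesgue (\<Union>p\<in>G. ball (?M p) (1 / 2)) = card G * (pi / 4)" .
    have "(\<Union>p\<in>G. ball (?M p) (1 / 2)) \<subseteq> ?T ` ball 0 25"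
    proof
      fix y assume "y \<in> (\<Union>p\<in>G. ball (?M p) (1 / 2))"
      then obtain p where p: "p \<in> G" "dist (?M p) y < 1 / 2" by auto
      obtain v where v: "?T v = y" using surjD[OF surj_fib_map_funpow[of k], of y] by metis
      have "norm p \<le> 12" using p(1) G(1) by auto
      have "1 \<le> (5 / 4 :: real) ^ k" by simp
      then have "norm (v - p) \<le> (5 / 4) ^ k * norm (v - p)"
        by (simp add: mult_le_cancel_right1)
      also have "\<dots> \<le> norm (?T (v - p))" by (rule norm_fib_map_funpow_ge)
      also have "?T (v - p) = (y - ?M p) - p"
        by (simp add: linear_diff[OF linear_fib_map_funpow] v)
      also have "norm \<dots> \<le> norm (y - ?M p) + norm p" by (rule norm_triangle_ineq4)
      also have "\<dots> < 1 / 2 + 12"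
        using p(2) \<open>norm p \<le> 12\<close> by (simp add: dist_norm norm_minus_commute)
      finally have "norm v < 25" using \<open>norm p \<le> 12\<close> norm_triangle_sub[of v p] by linarith
      then show "y \<in> ?T ` ball 0 25" using v by auto
    qed
    then have "measure lebesgue (\<Union>p\<in>G. ball (?M p) (1 / 2)) \<le> measure lebesgue (?T ` ball 0 25)"
      using G(2) by (intro measure_mono_fmeasurable fib_map_funpow_image) auto
    also have "\<dots> = 5 ^ k * (pi * 25\<^sup>2)"
      by (subst fib_map_funpow_image(2), simp, subst measure_lebesgue_disc) simp_all
    finally have "real (card G) * (pi / 4) \<le> (5 ^ k * 2500) * (pi / 4)" unfolding union by simp
    then have "real (card G) \<le> real (2500 * 5 ^ k)" by simp
    then show ?thesis by linarith
  qed
  then have "finite (fixed_lifts k \<inter> cball 0 12) \<and> card (fixed_lifts k \<inter> cball 0 12) \<le> 2500 * 5 ^ k"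
    by (rule finite_if_finite_subsets_card_bdd)
  then show "finite (fixed_lifts k \<inter> cball 0 12)" "card (fixed_lifts k \<inter> cball 0 12) \<le> 2500 * 5 ^ k"
    by auto
qed

text \<open>The open \<open>r\<close>-neighbourhood of the fixed points of the \<open>k\<close>-th iterate on the torus.\<close>

definition near_periodic :: "nat \<Rightarrow> real \<Rightarrow> torus2 set" where
  "near_periodic k r = (\<Union>p\<in>fixed_lifts k. ball (torus_proj p) r)"

lemma open_near_periodic: "open (near_periodic k r)"
  by (auto simp: near_periodic_def)

lemma emeasure_near_periodic_le:
  assumes "k > 0" and "0 < r" "r \<le> 9"
  shows "emeasure torus_lebesgue (near_periodic k r) \<le> ennreal (2500 * 5 ^ k * (pi * r\<^sup>2))"
proof -
  let ?P = "fixed_lifts k \<inter> cball 0 12"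
  have "torus_proj -` near_periodic k r \<inter> unit_square \<subseteq> (\<Union>p\<in>?P. ball p r)"
  proof
    fix x assume "x \<in> torus_proj -` near_periodic k r \<inter> unit_square"
    then obtain p where p: "p \<in> fixed_lifts k" "dist (torus_proj x) (torus_proj p) < r"
      and x: "\<And>i. 0 \<le> x $ i \<and> x $ i < 1"
      by (auto simp: near_periodic_def unit_square_def dist_commute)
    obtain p' where p': "torus_proj p' = torus_proj p" "dist x p' < r"
      using p(2) dist_torus_proj_less_iff by blast
    have "lattice_rel p' p" using p'(1) torus_proj_eq_iff by blast
    then have "p' \<in> fixed_lifts k"
      using p(1) lattice_rel_fib_map_funpow lattice_rel_sym lattice_rel_trans
      unfolding fixed_lifts_def mem_Collect_eq by meson
    moreover have "norm p' \<le> 12"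
    proof -
      have "norm x \<le> \<bar>x $ 1\<bar> + \<bar>x $ 2\<bar>" using norm_le_l1_cart[of x] by (simp add: sum_2)
      then have "norm x \<le> 2" using x[of 1] x[of 2] by simp
      moreover have "norm p' \<le> norm x + dist x p'"
        using norm_triangle_sub[of p' x] by (simp add: dist_norm norm_minus_commute)
      ultimately show ?thesis using p'(2) assms(3) by linarith
    qed
    ultimately show "x \<in> (\<Union>p\<in>?P. ball p r)" using p'(2) by (auto simp: dist_commute)
  qed
  then have "emeasure lborel (torus_proj -` near_periodic k r \<inter> unit_square)
      \<le> emeasure lborel (\<Union>p\<in>?P. ball p r)"
    by (intro emeasure_mono) (simp_all add: borel_open open_UN)
  also have "\<dots> \<le> (\<Sum>p\<in>?P. emeasure lborel (ball p r))"
    using card_fixed_lifts_le(1)[OF assms(1)] by (intro emeasure_subadditive_finite) auto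
  also have "\<dots> = (\<Sum>p\<in>?P. ennreal (pi * r\<^sup>2))"
    using assms(2) by (intro sum.cong refl) (simp add: emeasure_ball unit_ball_vol_2)
  also have "\<dots> = ennreal (card ?P * (pi * r\<^sup>2))"
    by (simp add: ennreal_mult ennreal_of_nat_eq_real_of_nat)
  also have "\<dots> \<le> ennreal (2500 * 5 ^ k * (pi * r\<^sup>2))"
  proof (intro ennreal_leI mult_right_mono)
    have "real (card ?P) \<le> real (2500 * 5 ^ k)"
      using card_fixed_lifts_le(2)[OF assms(1)] by (rule of_nat_mono)
    then show "real (card ?P) \<le> 2500 * 5 ^ k" by simp
  qed simp
  finally show ?thesis
    using emeasure_torus_lebesgue[of "near_periodic k r"] open_near_periodic by simp
qed

section \<open>Return times from below\<close>

text \<open>The number of time steps given up below \<open>2m\<close> at radius \<open>5\<^sup>-\<^sup>m\<close>: large enough that \<open>5\<close> to the power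
  of minus the gap is summable, and small compared with \<open>m\<close>.\<close>

definition log_gap :: "nat \<Rightarrow> nat" where
  "log_gap m = nat \<lceil>2 * log 5 (real m + 1)\<rceil>"

lemma power_log_gap_ge: "(real m + 1)\<^sup>2 \<le> 5 ^ log_gap m"
proof -
  have "(real m + 1)\<^sup>2 = 5 powr (2 * log 5 (real m + 1))"
    by (simp add: powr_powr[symmetric] powr_realpow mult.commute[of 2] flip: powr_numeral)
  also have "\<dots> \<le> 5 powr (real (log_gap m))"
    unfolding log_gap_def by (intro powr_mono) linarith+
  also have "\<dots> = 5 ^ log_gap m" by (simp add: powr_realpow)
  finally show ?thesis .
qed

text \<open>An open set that contains every point whose ball of radius \<open>5\<^sup>-\<^sup>m\<close> returns by time
  \<open>2m - log_gap m\<close>. The subtraction truncates: the set is empty if the gap is at least \<open>2m\<close>.\<close>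

definition early_returns :: "nat \<Rightarrow> torus2 set" where
  "early_returns m = (\<Union>k\<in>{1..2 * m - log_gap m}. near_periodic k (9 * (1 / 5) ^ m))"

lemma sum_power_5_le: "(\<Sum>k = 1..n. (5::real) ^ k) \<le> 5 / 4 * 5 ^ n"
  by (induction n) (simp_all add: field_simps)

lemma emeasure_early_returns_le:
  "emeasure torus_lebesgue (early_returns m) \<le> ennreal (253125 * pi / (real m + 1)\<^sup>2)"
proof -
  let ?N = "2 * m - log_gap m" and ?r = "9 * (1 / 5 :: real) ^ m"
  have r: "0 < ?r" "?r \<le> 9" by (auto simp: power_le_one)
  have r_sq: "?r\<^sup>2 = 81 / 5 ^ (2 * m)"
    by (simp add: power_mult_distrib power_one_over power_divide power_mult[symmetric]
        mult.commute)
  have "emeasure torus_lebesgue (early_returns m)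
      \<le> (\<Sum>k = 1..?N. emeasure torus_lebesgue (near_periodic k ?r))"
    unfolding early_returns_def
    by (intro emeasure_subadditive_finite) (auto simp: torus_lebesgue_def open_near_periodic)
  also have "\<dots> \<le> (\<Sum>k = 1..?N. ennreal (2500 * 5 ^ k * (pi * ?r\<^sup>2)))"
    by (intro sum_mono emeasure_near_periodic_le r) auto
  also have "\<dots> = ennreal (2500 * (\<Sum>k = 1..?N. 5 ^ k) * (pi * ?r\<^sup>2))"
    by (subst sum_ennreal) (simp_all add: sum_distrib_left sum_distrib_right)
  also have "\<dots> \<le> ennreal (253125 * pi / (real m + 1)\<^sup>2)"
    \<comment> \<open>If the gap exceeds \<open>2m\<close>, the sum is empty.\<close>
  proof (rule ennreal_leI, cases "log_gap m \<le> 2 * m")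
    case True
    have "(\<Sum>k = 1..?N. (5::real) ^ k) \<le> 5 / 4 * 5 ^ ?N" by (rule sum_power_5_le)
    also have "(5::real) ^ ?N = 5 ^ (2 * m) / 5 ^ log_gap m" using True by (simp add: power_diff)
    also have "\<dots> \<le> 5 ^ (2 * m) / (real m + 1)\<^sup>2"
      by (intro divide_left_mono power_log_gap_ge mult_pos_pos) auto
    finally have "(\<Sum>k = 1..?N. (5::real) ^ k) \<le> 5 / 4 * (5 ^ (2 * m) / (real m + 1)\<^sup>2)" by simp
    then have "2500 * (\<Sum>k = 1..?N. 5 ^ k) * (pi * ?r\<^sup>2)
        \<le> 2500 * (5 / 4 * (5 ^ (2 * m) / (real m + 1)\<^sup>2)) * (pi * ?r\<^sup>2)"
      by (intro mult_right_mono mult_left_mono) auto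
    also have "\<dots> = 253125 * pi / (real m + 1)\<^sup>2"
      unfolding r_sq by simp
    finally show "2500 * (\<Sum>k = 1..?N. 5 ^ k) * (pi * ?r\<^sup>2) \<le> 253125 * pi / (real m + 1)\<^sup>2" .
  qed auto
  finally show ?thesis .
qed

lemma AE_eventually_not_early_returns:
  "AE p in torus_lebesgue. eventually (\<lambda>m. p \<notin> early_returns m) sequentially"
proof -
  have "open (early_returns m)" for m
    by (auto simp: early_returns_def open_near_periodic)
  then have 1: "early_returns m \<in> sets torus_lebesgue" for m
    by (simp add: torus_lebesgue_def)
  have 2: "emeasure torus_lebesgue (early_returns m) < \<infinity>" for m
    using emeasure_early_returns_le by (rule le_less_trans) simp
  have "summable (\<lambda>m. 253125 * pi / (real m + 1)\<^sup>2)"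
  proof -
    have "summable (\<lambda>m. inverse (real (Suc m) ^ 2))"
      using inverse_power_summable[of 2, where ?'a = real] by (subst summable_Suc_iff) auto
    then have "summable (\<lambda>m. 253125 * pi * inverse (real (Suc m) ^ 2))"
      by (rule summable_mult)
    then show ?thesis by (simp add: divide_inverse add.commute)
  qed
  then have 3: "summable (\<lambda>m. measure torus_lebesgue (early_returns m))"
  proof (rule summable_comparison_test')
    show "norm (measure torus_lebesgue (early_returns m)) \<le> 253125 * pi / (real m + 1)\<^sup>2" for m
      using emeasure_early_returns_le[of m] unfolding measure_def
      by (simp add: enn2real_leI)
  qed
  from borel_cantelli_AE1[OF 1 2 3] show ?thesis by (rule AE_mp) (auto elim: eventually_mono)
qed

lemma return_time_ge:
  assumes "p \<notin> early_returns m"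
  shows "enat (2 * m - log_gap m) \<le> return_time (torus_map fib_matrix) (ball p ((1 / 5) ^ m))"
  unfolding return_time_def
proof (rule Inf_greatest, clarify)
  fix k :: nat
  assume k: "k > 0"
    and ret: "(torus_map fib_matrix ^^ k) ` ball p ((1 / 5) ^ m) \<inter> ball p ((1 / 5) ^ m) \<noteq> {}"
  obtain x where x: "torus_proj x = p" using torus_proj_surj by blast
  obtain q where q: "q \<in> fixed_lifts k" "dist x q < 9 * (1 / 5) ^ m"
    using return_imp_near_fixed_lift[OF k, of x] ret x by blast
  then have "dist (torus_proj q) p < 9 * (1 / 5) ^ m"
    using dist_torus_proj_le[of q x] by (simp add: x dist_commute)
  then have "p \<in> near_periodic k (9 * (1 / 5) ^ m)"
    using q(1) by (auto simp: near_periodic_def)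
  then have "k \<notin> {1..2 * m - log_gap m}" using assms by (auto simp: early_returns_def)
  then show "enat (2 * m - log_gap m) \<le> enat k" using k by simp
qed

lemma return_time_antimono: "E \<subseteq> F \<Longrightarrow> return_time f F \<le> return_time f E"
  unfolding return_time_def by (intro Inf_superset_mono) blast

lemma log_gap_le: "real (log_gap m) \<le> 2 * log 5 (real m + 1) + 1"
proof -
  have "0 \<le> log 5 (real m + 1)" by simp
  then show ?thesis unfolding log_gap_def by linarith
qed

section \<open>The almost sure limit\<close>

lemma return_time_bounds:
  assumes r: "0 < r" "r < 1" and p: "p \<notin> early_returns (nat \<lfloor>- ln r / ln 5\<rfloor>)"
  obtains n where "return_time (torus_map fib_matrix) (ball p r) = enat n"
    and "2 * (- ln r / ln 5 - 1) - (2 * (ln (- ln r / ln 5 + 1) / ln 5) + 1) \<le> real n"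
    and "real n \<le> 2 * (- ln r / ln 5 + 1)"
proof -
  define L where "L = - ln r / ln 5"
  \<comment> \<open>The choice of \<open>m\<close> gives \<open>5\<^sup>-\<^sup>m\<^sup>-\<^sup>1 < r \<le> 5\<^sup>-\<^sup>m\<close>.\<close>
  define m where "m = nat \<lfloor>L\<rfloor>"
  have L: "0 < L" unfolding L_def using r by (intro divide_pos_pos) auto
  then have m: "real m \<le> L" "L < real m + 1" unfolding m_def by linarith+
  have r_eq: "r = exp (- L * ln 5)" using r by (simp add: L_def)
  have pow: "(1 / 5) ^ j = exp (- real j * ln 5)" for j
    by (simp add: exp_minus exp_of_nat_mult power_one_over inverse_eq_divide)
  have "(1 / 5) ^ (m + 1) < r"
    unfolding pow r_eq exp_less_cancel_iff using m by (intro mult_strict_right_mono) auto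
  then have upper: "return_time (torus_map fib_matrix) (ball p r) \<le> enat (2 * (m + 1))"
    by (intro return_time_le) auto
  then obtain n where n: "return_time (torus_map fib_matrix) (ball p r) = enat n" "n \<le> 2 * (m + 1)"
    by (cases "return_time (torus_map fib_matrix) (ball p r)") auto
  have "r \<le> (1 / 5) ^ m"
    unfolding pow r_eq exp_le_cancel_iff using m by (intro mult_right_mono) auto
  then have "ball p r \<subseteq> ball p ((1 / 5) ^ m)" by (rule subset_ball)
  then have "return_time (torus_map fib_matrix) (ball p ((1 / 5) ^ m)) \<le> enat n"
    using return_time_antimono n(1) by metis
  moreover have "enat (2 * m - log_gap m)
      \<le> return_time (torus_map fib_matrix) (ball p ((1 / 5) ^ m))"
    using p return_time_ge by (simp add: m_def L_def)
  ultimately have "enat (2 * m - log_gap m) \<le> enat n" by (rule order_trans[rotated])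
  then have "2 * real m - real (log_gap m) \<le> real n" by simp
  moreover have "log 5 (real m + 1) \<le> log 5 (L + 1)" using m by simp
  ultimately have "2 * (L - 1) - (2 * (ln (L + 1) / ln 5) + 1) \<le> real n"
    using log_gap_le[of m] m(2) by (simp add: log_def)
  moreover have "real n \<le> 2 * (L + 1)"
    using of_nat_mono[OF n(2), where ?'a = real] m(1) by simp
  ultimately show thesis using that n(1) by (simp add: L_def)
qed

lemma tendsto_return_time:
  assumes "eventually (\<lambda>m. p \<notin> early_returns m) sequentially"
  shows "((\<lambda>r. ereal_of_enat (return_time (torus_map fib_matrix) (ball p r)) / ereal (- ln r))
    \<longlongrightarrow> ereal (2 / ln 5)) (at_right 0)"
proof (rule tendsto_sandwich)
  let ?l = "\<lambda>r::real. (2 * (- ln r / ln 5 - 1) - (2 * (ln (- ln r / ln 5 + 1) / ln 5) + 1)) / (- ln r)"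
  let ?u = "\<lambda>r::real. (2 * (- ln r / ln 5 + 1)) / (- ln r)"
  have "(?l \<longlongrightarrow> 2 / ln 5) (at_right 0)" by real_asymp (simp add: divide_inverse)
  then show "((\<lambda>r. ereal (?l r)) \<longlongrightarrow> ereal (2 / ln 5)) (at_right 0)" by simp
  have "(?u \<longlongrightarrow> 2 / ln 5) (at_right 0)" by real_asymp (simp add: divide_inverse)
  then show "((\<lambda>r. ereal (?u r)) \<longlongrightarrow> ereal (2 / ln 5)) (at_right 0)" by simp
  have "filterlim (\<lambda>r::real. nat \<lfloor>- ln r / ln 5\<rfloor>) sequentially (at_right 0)"
  proof (rule filterlim_compose[OF filterlim_nat_sequentially])
    show "filterlim (\<lambda>r::real. \<lfloor>- ln r / ln 5\<rfloor>) at_top (at_right 0)"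
      by (rule filterlim_compose[OF filterlim_floor_sequentially]) real_asymp
  qed
  then have "eventually (\<lambda>r::real. p \<notin> early_returns (nat \<lfloor>- ln r / ln 5\<rfloor>)) (at_right 0)"
    using assms by (rule eventually_compose_filterlim[rotated])
  moreover have "eventually (\<lambda>r::real. 0 < r \<and> r < 1) (at_right 0)"
    by (rule eventually_at_rightI[of 0 1]) auto
  ultimately have ev: "eventually (\<lambda>r::real. 0 < r \<and> r < 1 \<and>
      p \<notin> early_returns (nat \<lfloor>- ln r / ln 5\<rfloor>)) (at_right 0)"
    by eventually_elim auto
  show "eventually (\<lambda>r. ereal (?l r) \<le>
      ereal_of_enat (return_time (torus_map fib_matrix) (ball p r)) / ereal (- ln r)) (at_right 0)"
    using ev
  proof eventually_elim
    case (elim r)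
    then obtain n where n: "return_time (torus_map fib_matrix) (ball p r) = enat n"
      and le: "2 * (- ln r / ln 5 - 1) - (2 * (ln (- ln r / ln 5 + 1) / ln 5) + 1) \<le> real n"
      using return_time_bounds by blast
    have "?l r \<le> real n / (- ln r)" using le elim by (intro divide_right_mono) auto
    then show ?case using elim unfolding n ereal_of_enat_simps by simp
  qed
  show "eventually (\<lambda>r. ereal_of_enat (return_time (torus_map fib_matrix) (ball p r)) / ereal (- ln r)
      \<le> ereal (?u r)) (at_right 0)"
    using ev
  proof eventually_elim
    case (elim r)
    then obtain n where n: "return_time (torus_map fib_matrix) (ball p r) = enat n"
      and le: "real n \<le> 2 * (- ln r / ln 5 + 1)"
      using return_time_bounds by blast
    have "real n / (- ln r) \<le> ?u r" using le elim by (intro divide_right_mono) auto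
    then show ?case using elim unfolding n ereal_of_enat_simps by simp
  qed
qed

theorem proposition4p3:
  "\<exists>(A :: int^2^2) f. expanding_matrix A \<and> f = torus_map A \<and>
     1 / max_lyapunov A < 2 / (max_lyapunov A + min_lyapunov A) \<and>
     2 / (max_lyapunov A + min_lyapunov A) < 1 / min_lyapunov A \<and>
     (AE x in torus_lebesgue.
        ((\<lambda>r::real. ereal_of_enat (return_time f (ball x r)) / ereal (- ln r))
          \<longlongrightarrow> ereal (2 / (max_lyapunov A + min_lyapunov A))) (at_right 0))"
proof (intro exI conjI)
  show "expanding_matrix fib_matrix" by (rule expanding_fib_matrix)
  show "torus_map fib_matrix = torus_map fib_matrix" ..
  show "1 / max_lyapunov fib_matrix < 2 / (max_lyapunov fib_matrix + min_lyapunov fib_matrix)"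
    "2 / (max_lyapunov fib_matrix + min_lyapunov fib_matrix) < 1 / min_lyapunov fib_matrix"
    using min_lyapunov_fib_matrix_pos min_less_max_lyapunov_fib_matrix
    by (simp_all add: divide_simps)
  show "AE x in torus_lebesgue.
      ((\<lambda>r. ereal_of_enat (return_time (torus_map fib_matrix) (ball x r)) / ereal (- ln r))
        \<longlongrightarrow> ereal (2 / (max_lyapunov fib_matrix + min_lyapunov fib_matrix))) (at_right 0)"
    using AE_eventually_not_early_returns unfolding sum_lyapunov_fib_matrix
    by (rule AE_mp) (auto intro: tendsto_return_time)
qed

end
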